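(* For any connected bicyclic graph $G$ with cycle sizes $s\le t$ meeting along $\ell\le s/2$ edges, $s$ and $t$ can be recovered from $\mathbf{X}_G$. Furthermore, if $\ell\ge2$, one can detect from $\mathbf{X}_G$ that $G$ is of type-II, and recover $\ell$. Explicitly: let $G$ and $G'$ be connected bicyclic graphs with parameters $(s,t,\ell)$ and $(s',t',\ell')$ respectively (normalized as in the context), and suppose $\mathbf{X}_G=\mathbf{X}_{G'}$. Then $s=s'$ and $t=t'$; and if $\ell\ge2$, then $G'$ is also of type-II and $\ell'=\ell$.
   Context: All graphs are finite and simple. The chromatic symmetric function of a graph $G$ with vertices $v_1,\dots,v_n$ is $\mathbf{X}_G=\sum_\kappa x_{\kappa(v_1)}\cdots x_{\kappa(v_n)}$, summed over all proper colorings $\kappa:V(G)\to\mathbb{N}$. A bicyclic graph is a simple connected graph whose number of edges equals its number of vertices plus one. $P_h$ denotes the path on $h$ vertices. Every bicyclic graph $G$ has a unique minimal bicyclic subgraph $\tilde G$, of one of two forms. Type-I: $\tilde G$ consists of two cycles $C_s$ and $C_t$ joined by a path $P_h$, $h\ge1$, from a vertex of $C_s$ to a vertex of $C_t$ (for $h=1$ the two cycles share a single vertex). Type-II: $\tilde G$ is formed from three paths $P_{k+1},P_{\ell+1},P_{m+1}$ with $k,\ell,m\ge1$, at most one of them equal to $1$, by identifying all initial vertices to one vertex $u$ and all terminal vertices to one vertex $v$ (otherwise disjoint); equivalently two cycles of lengths $\ell+k$ and $\ell+m$ meeting along a common path with $\ell$ edges. $G$ is called type-I or type-II according to $\tilde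 G$. Normalization of the parameters $(s,t,\ell)$: for type-I, $s\le t$ are the sizes of the two cycles and $\ell=0$; for type-II, the three path lengths are named so that $\ell\le k\le m$, and $s=\ell+k$ (the girth of $G$), $t=\ell+m$, so that $\ell\le s/2$. "Recovered/detected from $\mathbf{X}_G$" means determined by $\mathbf{X}_G$ among bicyclic graphs. *)

theory Defs
  imports "HOL-Library.Multiset" "HOL-Library.FuncSet"
begin

record 'a graph =
  verts :: "'a set"
  edges :: "'a set set"

definition simple_graph :: "'a graph \<Rightarrow> bool" where
  "simple_graph G \<longleftrightarrow>
     finite (verts G) \<and> (\<forall>e\<in>edges G. \<exists>u\<in>verts G. \<exists>v\<in>verts G. u \<noteq> v \<and> e = {u, v})"

definition subgraph :: "'a graph \<Rightarrow> 'a graph \<Rightarrow> bool" where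
  "subgraph H G \<longleftrightarrow> simple_graph H \<and> verts H \<subseteq> verts G \<and> edges H \<subseteq> edges G"

definition connected_graph :: "'a graph \<Rightarrow> bool" where
  "connected_graph G \<longleftrightarrow> verts G \<noteq> {} \<and>
     (\<forall>u\<in>verts G. \<forall>v\<in>verts G. (u, v) \<in> {(x, y). {x, y} \<in> edges G}\<^sup>*)"

definition bicyclic :: "'a graph \<Rightarrow> bool" where
  "bicyclic G \<longleftrightarrow>
     simple_graph G \<and> connected_graph G \<and> card (edges G) = card (verts G) + 1"

definition minimal_bicyclic_subgraph :: "'a graph \<Rightarrow> 'a graph \<Rightarrow> bool" where
  "minimal_bicyclic_subgraph H G \<longleftrightarrow> subgraph H G \<and> bicyclic H \<and>
     (\<forall>K. subgraph K H \<and> bicyclic K \<longrightarrow> K = H)"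

text \<open>
  Paths and cycles are given by the list of their vertices in order, without repetition. The list
  of a cycle does not return to its first vertex, so its length is the size of the cycle; a path
  list of length \<open>h\<close> is a path on \<open>h\<close> vertices, with \<open>h - 1\<close> edges.
\<close>

definition is_path :: "'a list \<Rightarrow> bool" where
  "is_path p \<longleftrightarrow> p \<noteq> [] \<and> distinct p"

definition path_edges :: "'a list \<Rightarrow> 'a set set" where
  "path_edges p = {{p ! i, p ! Suc i} | i. Suc i < length p}"

definition is_cycle :: "'a list \<Rightarrow> bool" where
  "is_cycle c \<longleftrightarrow> length c \<ge> 3 \<and> distinct c"

definition cycle_edges :: "'a list \<Rightarrow> 'a set set" where
  "cycle_edges c = insert {last c, hd c} (path_edges c)"

text \<open>
  Cycles of sizes \<open>s\<close> and \<open>t\<close> joined by a path, which is a single vertex shared by the two cycles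
  if \<open>length p = 1\<close>.
\<close>

definition type_I_core :: "'a graph \<Rightarrow> nat \<Rightarrow> nat \<Rightarrow> bool" where
  "type_I_core H s t \<longleftrightarrow>
     (\<exists>c d p. is_cycle c \<and> length c = s \<and> is_cycle d \<and> length d = t \<and> is_path p \<and>
        set c \<inter> set p = {hd p} \<and> set d \<inter> set p = {last p} \<and>
        set c \<inter> set d = (if length p = 1 then {hd p} else {}) \<and>
        verts H = set c \<union> set d \<union> set p \<and>
        edges H = cycle_edges c \<union> cycle_edges d \<union> path_edges p)"

text \<open>
  Three paths with \<open>k\<close>, \<open>l\<close> and \<open>m\<close> edges, at most one of them a single edge, with common end
  vertices and otherwise disjoint.
\<close>

definition type_II_core :: "'a graph \<Rightarrow> nat \<Rightarrow> nat \<Rightarrow> nat \<Rightarrow> bool" where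
  "type_II_core H k l m \<longleftrightarrow>
     k \<ge> 1 \<and> l \<ge> 1 \<and> m \<ge> 1 \<and>
     \<not> (k = 1 \<and> l = 1) \<and> \<not> (k = 1 \<and> m = 1) \<and> \<not> (l = 1 \<and> m = 1) \<and>
     (\<exists>u v p q r. is_path p \<and> length p = k + 1 \<and> hd p = u \<and> last p = v \<and>
        is_path q \<and> length q = l + 1 \<and> hd q = u \<and> last q = v \<and>
        is_path r \<and> length r = m + 1 \<and> hd r = u \<and> last r = v \<and>
        set p \<inter> set q = {u, v} \<and> set p \<inter> set r = {u, v} \<and> set q \<inter> set r = {u, v} \<and>
        verts H = set p \<union> set q \<union> set r \<and>
        edges H = path_edges p \<union> path_edges q \<union> path_edges r)"

definition type_II :: "'a graph \<Rightarrow> bool" where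
  "type_II G \<longleftrightarrow>
     (\<exists>H k l m. minimal_bicyclic_subgraph H G \<and> type_II_core H k l m)"

definition has_parameters :: "'a graph \<Rightarrow> nat \<Rightarrow> nat \<Rightarrow> nat \<Rightarrow> bool" where
  "has_parameters G s t l \<longleftrightarrow>
     (\<exists>H. minimal_bicyclic_subgraph H G \<and>
        (type_I_core H s t \<and> s \<le> t \<and> l = 0 \<or>
         (\<exists>k m. type_II_core H k l m \<and> l \<le> k \<and> k \<le> m \<and> s = l + k \<and> t = l + m)))"

definition proper_colorings :: "'a graph \<Rightarrow> ('a \<Rightarrow> nat) set" where
  "proper_colorings G =
     {\<kappa> \<in> verts G \<rightarrow>\<^sub>E UNIV. \<forall>u v. {u, v} \<in> edges G \<longrightarrow> \<kappa> u \<noteq> \<kappa> v}"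

text \<open>
  A formal power series in the variables \<open>x\<^sub>0, x\<^sub>1, x\<^sub>2, \<dots>\<close> is represented by its coefficients. The
  monomials are the finite multisets of variable indices, and the product of the \<open>x\<^bsub>\<kappa> v\<^esub>\<close>
  over all vertices \<open>v\<close> is the multiset of the colors used by \<open>\<kappa>\<close>. The coefficient of a monomial
  is therefore the number of proper colorings contributing that monomial to the defining sum.
\<close>

definition color_monomial :: "'a graph \<Rightarrow> ('a \<Rightarrow> nat) \<Rightarrow> nat multiset" where
  "color_monomial G \<kappa> = image_mset \<kappa> (mset_set (verts G))"

definition chromatic_symmetric_function :: "'a graph \<Rightarrow> nat multiset \<Rightarrow> int" where
  "chromatic_symmetric_function G M =
     int (card {\<kappa> \<in> proper_colorings G. color_monomial G \<kappa> = M})"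

lemma finite_colorings_of_monomial:
  assumes "finite (verts G)"
  shows "finite {\<kappa> \<in> proper_colorings G. color_monomial G \<kappa> = M}"
proof (rule finite_subset)
  show "{\<kappa> \<in> proper_colorings G. color_monomial G \<kappa> = M} \<subseteq> verts G \<rightarrow>\<^sub>E set_mset M"
    using assms by (auto simp: proper_colorings_def color_monomial_def PiE_iff extensional_def)
  show "finite (verts G \<rightarrow>\<^sub>E set_mset M)"
    using assms by (intro finite_PiE) auto
qed

end

theory Submission
  imports Defs "HOL-Computational_Algebra.Polynomial"
begin

text \<open>
  The chromatic polynomial, which is a specialization of the chromatic symmetric function, suffices.
  Put \<open>z = 1 - q\<close> and let \<open>n\<close> be the number of vertices. Pendant trees contribute a power of \<open>- z\<close>,
  and counting colorings of cycles and of three paths with common ends shows that \<open>q\<close> times the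
  number of colorings with \<open>q\<close> colors is, for both types and up to the sign \<open>(- 1) ^ (n + 1)\<close>,
  \<open>z^(n+1) + z^(n+3+l-s-t) + z^(n+2+l-s-t) - z^(n+2-s) - z^(n+2-t) - z^(n+2+2l-s-t)\<close>.
  For \<open>l \<le> 1\<close> one positive and one negative term cancel, leaving the same polynomial for \<open>l = 0\<close> and
  \<open>l = 1\<close>; for \<open>l \<ge> 2\<close> nothing cancels. In all cases the exponents determine \<open>s\<close> and \<open>t\<close>, and \<open>l\<close> if
  \<open>l \<ge> 2\<close>.
\<close>

section \<open>Counting colorings with finitely many colors\<close>

text \<open>Vertex and edge sets are separate arguments, so that a graph can be built up one vertex
  or edge at a time.\<close>

definition colorings :: "nat \<Rightarrow> 'a set \<Rightarrow> 'a set set \<Rightarrow> ('a \<Rightarrow> nat) set" where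
  "colorings q V E = {\<kappa> \<in> V \<rightarrow>\<^sub>E {..<q}. \<forall>u v. {u, v} \<in> E \<longrightarrow> \<kappa> u \<noteq> \<kappa> v}"

lemma finite_colorings: "finite V \<Longrightarrow> finite (colorings q V E)"
  by (rule finite_subset[of _ "V \<rightarrow>\<^sub>E {..<q}"]) (auto simp: colorings_def intro!: finite_PiE)

lemma colorings_lessD: "\<kappa> \<in> colorings q V E \<Longrightarrow> v \<in> V \<Longrightarrow> \<kappa> v < q"
  by (auto simp: colorings_def)

lemma sum_colorings_insert_edge:
  fixes f :: "('a \<Rightarrow> nat) \<Rightarrow> int"
  assumes "finite V"
  shows "(\<Sum>\<kappa>\<in>colorings q V (insert {u, v} E). f \<kappa>) =
         (\<Sum>\<kappa>\<in>colorings q V E. of_bool (\<kappa> u \<noteq> \<kappa> v) * f \<kappa>)"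
proof -
  have "colorings q V (insert {u, v} E) = {\<kappa> \<in> colorings q V E. \<kappa> u \<noteq> \<kappa> v}"
    by (auto simp: colorings_def doubleton_eq_iff)
  then show ?thesis
    using finite_colorings[OF assms]
    by (simp add: sum.inter_filter of_bool_def if_distrib[of "\<lambda>x. x * _"] cong: if_cong)
qed

text \<open>No edge of \<open>E\<close> meets \<open>w\<close>, so a coloring of the larger graph
  amounts to a coloring of the old one and any color for \<open>w\<close> other than that of
  \<open>u\<close>. The weight \<open>f\<close> is needed for ears, whose count depends on the
  colors of their ends.\<close>

lemma sum_colorings_insert_pendant:
  fixes f :: "('a \<Rightarrow> nat) \<Rightarrow> int"
  assumes "finite V" "u \<in> V" "w \<notin> V" "E \<subseteq> Pow V"
  shows "(\<Sum>\<kappa>\<in>colorings q (insert w V) (insert {u, w} E). f \<kappa>) =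
         (\<Sum>\<kappa>\<in>colorings q V E. \<Sum>c\<in>{..<q} - {\<kappa> u}. f (\<kappa>(w := c)))"
proof -
  have notE: "{x, w} \<notin> E" "{w, x} \<notin> E" for x
    using assms by auto
  have uw: "u \<noteq> w"
    using assms by auto
  have "(\<Sum>\<kappa>\<in>colorings q V E. \<Sum>c\<in>{..<q} - {\<kappa> u}. f (\<kappa>(w := c))) =
        (\<Sum>(\<kappa>, c)\<in>(SIGMA \<kappa>:colorings q V E. {..<q} - {\<kappa> u}). f (\<kappa>(w := c)))"
    by (rule sum.Sigma) (auto intro: finite_colorings assms)
  also have "\<dots> = (\<Sum>\<kappa>\<in>colorings q (insert w V) (insert {u, w} E). f \<kappa>)"
  proof (rule sum.reindex_bij_witness[where j = "\<lambda>(\<kappa>, c). \<kappa>(w := c)"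
        and i = "\<lambda>\<kappa>. (restrict \<kappa> V, \<kappa> w)"], goal_cases)
    case (1 a)
    then show ?case
      using assms by (fastforce simp: colorings_def PiE_def extensional_def restrict_def fun_eq_iff)
  next
    case (2 a)
    then obtain \<kappa> c where a: "a = (\<kappa>, c)" "\<kappa> \<in> colorings q V E" "c < q" "c \<noteq> \<kappa> u"
      by auto
    have "\<kappa>(w := c) \<in> insert w V \<rightarrow>\<^sub>E {..<q}"
      using a by (auto simp: colorings_def PiE_def extensional_def)
    moreover have "(\<kappa>(w := c)) x \<noteq> (\<kappa>(w := c)) y" if "{x, y} \<in> insert {u, w} E" for x y
      using that a uw notE by (auto simp: colorings_def doubleton_eq_iff)
    ultimately show ?case
      by (simp add: colorings_def a(1))
  next
    case (3 b)
    then show ?case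
      by (auto simp: colorings_def PiE_def extensional_def restrict_def fun_eq_iff)
  next
    case (4 b)
    then have b: "b \<in> insert w V \<rightarrow>\<^sub>E {..<q}"
      and proper: "\<And>x y. {x, y} \<in> insert {u, w} E \<Longrightarrow> b x \<noteq> b y"
      by (auto simp: colorings_def)
    have "x \<in> V \<and> y \<in> V" if "{x, y} \<in> E" for x y
      using that assms(4) by auto
    then have "restrict b V \<in> colorings q V E"
      using b proper by (auto simp: colorings_def)
    moreover have "b w < q" "b w \<noteq> b u"
      using b proper[of u w] by auto
    ultimately show ?case
      using assms(2) by auto
  qed auto
  finally show ?thesis ..
qed

lemma card_colorings_insert_pendant:
  assumes "finite V" "u \<in> V" "w \<notin> V" "E \<subseteq> Pow V"
  shows "int (card (colorings q (insert w V) (insert {u, w} E))) =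
         (int q - 1) * int (card (colorings q V E))"
proof -
  have "int (card (colorings q (insert w V) (insert {u, w} E))) =
        (\<Sum>\<kappa>\<in>colorings q V E. \<Sum>c\<in>{..<q} - {\<kappa> u}. 1)"
    using sum_colorings_insert_pendant[OF assms, of "\<lambda>_. 1" q] by simp
  also have "\<dots> = (\<Sum>\<kappa>\<in>colorings q V E. int q - 1)"
  proof (rule sum.cong[OF refl])
    fix \<kappa> assume "\<kappa> \<in> colorings q V E"
    then have "\<kappa> u < q"
      using assms(2) by (rule colorings_lessD)
    then show "(\<Sum>c\<in>{..<q} - {\<kappa> u}. 1) = int q - 1"
      by (simp add: card_Diff_singleton)
  qed
  finally show ?thesis
    by simp
qed


section \<open>Attaching trees, paths and ears\<close>

lemma path_edges_simps [simp]:
  fixes x y :: 'a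
  shows "path_edges ([] :: 'a list) = {}" "path_edges [x] = {}"
  "path_edges (x # y # xs) = insert {x, y} (path_edges (y # xs))"
proof -
  have image: "path_edges p = (\<lambda>i. {p ! i, p ! Suc i}) ` {i. Suc i < length p}" for p :: "'a list"
    by (auto simp: path_edges_def)
  have "{i. Suc i < length (x # y # xs)} = insert 0 (Suc ` {i. Suc i < length (y # xs)})"
  proof (intro set_eqI)
    fix i show "i \<in> {i. Suc i < length (x # y # xs)} \<longleftrightarrow>
      i \<in> insert 0 (Suc ` {i. Suc i < length (y # xs)})"
      by (cases i) auto
  qed
  then show "path_edges (x # y # xs) = insert {x, y} (path_edges (y # xs))"
    by (simp only: image image_insert image_image nth_Cons_0 nth_Cons_Suc)
qed (simp_all add: path_edges_def)

lemma path_edges_append: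
  "path_edges (xs @ a # ys) = path_edges (xs @ [a]) \<union> path_edges (a # ys)"
  by (induction xs rule: induct_list012) auto

lemma path_edges_subset: "path_edges p \<subseteq> Pow (set p)"
  by (induction p rule: induct_list012) auto

text \<open>Opening the cycle at \<open>a\<close> turns it into an ear from \<open>a\<close> back to
  \<open>a\<close>.\<close>

lemma cycle_edges_split:
  "cycle_edges (xs @ a # ys) = path_edges (a # (ys @ xs) @ [a])"
proof -
  have closed: "cycle_edges c = path_edges (c @ [hd c])" if "c \<noteq> []" for c :: "'a list"
  proof -
    have "path_edges (c @ [hd c]) = path_edges c \<union> {{last c, hd c}}"
      using path_edges_append[of "butlast c" "last c" "[hd c]"] that
      by (cases c rule: rev_cases) auto
    then show ?thesis
      by (auto simp: cycle_edges_def)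
  qed
  show ?thesis
  proof (cases xs)
    case Nil
    then show ?thesis
      by (simp add: closed)
  next
    case (Cons b zs)
    then have "cycle_edges (xs @ a # ys) = path_edges ((b # zs) @ a # (ys @ [b]))"
      by (simp add: closed)
    \<comment> \<open>The closed list is cut at \<open>a\<close>, and the two pieces are rejoined at
      \<open>b\<close> in the other order.\<close>
    also have "\<dots> = path_edges ((b # zs) @ [a]) \<union> path_edges (a # (ys @ [b]))"
      by (rule path_edges_append)
    also have "\<dots> = path_edges ((a # ys) @ b # (zs @ [a]))"
      by (subst path_edges_append[of "a # ys" b]) auto
    finally show ?thesis
      using Cons by simp
  qed
qed

lemma card_colorings_path:
  assumes "finite V" "u \<in> V" "distinct ws" "set ws \<inter> V = {}" "E \<subseteq> Pow V"
  shows "int (card (colorings q (V \<union> set ws) (E \<union> path_edges (u # ws)))) =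
         (int q - 1) ^ length ws * int (card (colorings q V E))"
  using assms
proof (induction ws arbitrary: V E u)
  case (Cons w ws)
  have "int (card (colorings q (insert w V \<union> set ws) (insert {u, w} E \<union> path_edges (w # ws)))) =
        (int q - 1) ^ length ws * int (card (colorings q (insert w V) (insert {u, w} E)))"
    using Cons.prems by (intro Cons.IH) auto
  also have "\<dots> = (int q - 1) ^ length (w # ws) * int (card (colorings q V E))"
    using Cons.prems by (subst card_colorings_insert_pendant) auto
  finally show ?case
    by simp
qed simp

text \<open>The number of ways to color the \<open>n\<close> inner vertices of a path whose ends
  have prescribed colors; by symmetry only equality of the end colors matters. The recursion runs
  over the color of the first inner vertex: among the colors other than that of the near end, at
  most one is the color of the far end.\<close>

fun ear_count :: "nat \<Rightarrow> nat \<Rightarrow> bool \<Rightarrow> int" where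
  "ear_count q 0 same = of_bool (\<not> same)"
| "ear_count q (Suc n) True = (int q - 1) * ear_count q n False"
| "ear_count q (Suc n) False = ear_count q n True + (int q - 2) * ear_count q n False"

text \<open>The powers of the adjacency matrix of the complete graph on \<open>q\<close> vertices,
  with eigenvalues \<open>q - 1\<close> and \<open>-1\<close>. The factor \<open>q\<close> avoids a
  division.\<close>

lemma ear_count_closed:
  "int q * ear_count q n same =
   (int q - 1) ^ Suc n + (- 1) ^ Suc n * (if same then int q - 1 else - 1)"
proof (induction n arbitrary: same)
  case (Suc n)
  show ?case
  proof (cases same)
    case True
    have "int q * ear_count q (Suc n) same = (int q - 1) * (int q * ear_count q n False)"
      using True by simp
    then show ?thesis
      unfolding Suc.IH using True by (simp add: algebra_simps)
  next
    case False
    have "int q * ear_count q (Suc n) same =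
          int q * ear_count q n True + (int q - 2) * (int q * ear_count q n False)"
      using False by (simp add: algebra_simps)
    then show ?thesis
      unfolding Suc.IH using False by (simp add: algebra_simps)
  qed
qed auto

lemma ear_count_Suc:
  assumes "a < q" "b < q"
  shows "(\<Sum>c\<in>{..<q} - {a}. ear_count q n (c = b)) = ear_count q (Suc n) (a = b)"
proof (cases "a = b")
  case True
  then have "(\<Sum>c\<in>{..<q} - {a}. ear_count q n (c = b)) =
             (\<Sum>c\<in>{..<q} - {a}. ear_count q n False)"
    by (intro sum.cong) auto
  then show ?thesis
    using True assms by (simp add: card_Diff_singleton)
next
  case False
  have "(\<Sum>c\<in>{..<q} - {a}. ear_count q n (c = b)) =
        ear_count q n True + (\<Sum>c\<in>{..<q} - {a} - {b}. ear_count q n (c = b))"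
    using False assms by (subst sum.remove[of _ b]) auto
  also have "(\<Sum>c\<in>{..<q} - {a} - {b}. ear_count q n (c = b)) =
             (\<Sum>c\<in>{..<q} - {a} - {b}. ear_count q n False)"
    by (intro sum.cong) auto
  also have "\<dots> = (int q - 2) * ear_count q n False"
  proof -
    have "card ({..<q} - {a} - {b}) = q - 2" "q \<ge> 2"
      using False assms by (auto simp: card_Diff_singleton)
    then show ?thesis
      by simp
  qed
  finally show ?thesis
    using False by simp
qed

text \<open>The case \<open>u = v\<close> is allowed: the ear is then a cycle through \<open>u\<close>, and an ear without inner
  vertices is a loop, which has no proper coloring.\<close>

lemma sum_colorings_ear:
  fixes g :: "nat \<Rightarrow> nat \<Rightarrow> int"
  assumes "finite V" "u \<in> V" "v \<in> V" "a \<in> V" "b \<in> V"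
    "distinct ws" "set ws \<inter> V = {}" "E \<subseteq> Pow V"
  shows "(\<Sum>\<kappa>\<in>colorings q (V \<union> set ws) (E \<union> path_edges (u # ws @ [v])). g (\<kappa> a) (\<kappa> b)) =
         (\<Sum>\<kappa>\<in>colorings q V E. ear_count q (length ws) (\<kappa> u = \<kappa> v) * g (\<kappa> a) (\<kappa> b))"
  using assms
proof (induction ws arbitrary: V E u)
  case Nil
  then show ?case
    by (simp add: sum_colorings_insert_edge)
next
  case (Cons w ws)
  have neq: "w \<noteq> v" "w \<noteq> a" "w \<noteq> b"
    using Cons.prems by auto
  have "(\<Sum>\<kappa>\<in>colorings q (V \<union> set (w # ws)) (E \<union> path_edges (u # (w # ws) @ [v])). g (\<kappa> a) (\<kappa> b)) =
        (\<Sum>\<kappa>\<in>colorings q (insert w V \<union> set ws) (insert {u, w} E \<union> path_edges (w # ws @ [v])). g (\<kappa> a) (\<kappa> b))"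
    by simp
  \<comment> \<open>The first inner vertex \<open>w\<close> is attached to \<open>u\<close> as a
    pendant vertex; the rest of the ear then runs from \<open>w\<close> to \<open>v\<close>.\<close>
  also have "\<dots> = (\<Sum>\<kappa>\<in>colorings q (insert w V) (insert {u, w} E).
               ear_count q (length ws) (\<kappa> w = \<kappa> v) * g (\<kappa> a) (\<kappa> b))"
    using Cons.prems by (intro Cons.IH) auto
  also have "\<dots> = (\<Sum>\<kappa>\<in>colorings q V E. \<Sum>c\<in>{..<q} - {\<kappa> u}.
               ear_count q (length ws) (c = \<kappa> v) * g (\<kappa> a) (\<kappa> b))"
    using Cons.prems neq by (subst sum_colorings_insert_pendant) auto
  also have "\<dots> = (\<Sum>\<kappa>\<in>colorings q V E.
               ear_count q (length (w # ws)) (\<kappa> u = \<kappa> v) * g (\<kappa> a) (\<kappa> b))"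
  proof (rule sum.cong[OF refl])
    fix \<kappa> assume "\<kappa> \<in> colorings q V E"
    then have "\<kappa> u < q" "\<kappa> v < q"
      using Cons.prems by (auto dest: colorings_lessD)
    then show "(\<Sum>c\<in>{..<q} - {\<kappa> u}. ear_count q (length ws) (c = \<kappa> v) * g (\<kappa> a) (\<kappa> b)) =
               ear_count q (length (w # ws)) (\<kappa> u = \<kappa> v) * g (\<kappa> a) (\<kappa> b)"
      by (simp only: sum_distrib_right[symmetric] ear_count_Suc list.size add_0_right add_Suc_right)
  qed
  finally show ?case .
qed

text \<open>The cycle is an ear with both ends at \<open>a\<close>, so its ends always agree in
  color and the ear contributes a constant factor.\<close>

lemma card_colorings_cycle:
  assumes "finite V" "distinct c" "set c \<inter> V = {a}" "E \<subseteq> Pow V"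
  shows "int (card (colorings q (V \<union> set c) (E \<union> cycle_edges c))) =
         ear_count q (length c - 1) True * int (card (colorings q V E))"
proof -
  have "a \<in> set c"
    using assms(3) by auto
  then obtain xs ys where c: "c = xs @ a # ys"
    by (meson split_list)
  have "V \<union> set c = V \<union> set (ys @ xs)"
    using assms(3) c by auto
  moreover have "set (ys @ xs) \<inter> V = {}"
  proof -
    have "set (ys @ xs) \<inter> V \<subseteq> set c \<inter> V"
      using c by auto
    then show ?thesis
      using assms(2,3) c by auto
  qed
  moreover have "a \<in> V"
    using assms(3) by auto
  ultimately show ?thesis
    using sum_colorings_ear[of V a a a a "ys @ xs" E "\<lambda>_ _. 1" q] assms c
    by (simp add: cycle_edges_split add.commute mult.commute Int_commute)
qed

text \<open>A connected graph with as many independent cycles as its subgraph \<open>(V, E)\<close> arises from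
  \<open>(V, E)\<close> by successively attaching pendant vertices.\<close>

lemma card_colorings_connected_supergraph:
  assumes "simple_graph G" "connected_graph G"
    "V \<subseteq> verts G" "V \<noteq> {}" "E \<subseteq> edges G" "E \<subseteq> Pow V"
    "card (edges G) + card V = card E + card (verts G)"
  shows "int (card (colorings q (verts G) (edges G))) =
         (int q - 1) ^ (card (verts G) - card V) * int (card (colorings q V E))"
  using assms
proof (induction "card (verts G) - card V" arbitrary: V E)
  have fin: "finite (verts G)"
    using assms(1) by (simp add: simple_graph_def)
  have finE: "finite (edges G)"
    by (rule finite_subset[of _ "Pow (verts G)"])
      (use assms(1) in \<open>auto simp: simple_graph_def\<close>)
  {
    case 0
    then have "V = verts G"
      using card_seteq[OF fin, of V] by simp
    moreover from this have "E = edges G"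
      using 0 card_seteq[OF finE, of E] by simp
    ultimately show ?case
      by simp
  next
    case (Suc n)
    have "V \<noteq> verts G"
      using Suc.hyps by auto
    then obtain x y where x: "x \<in> V" and y: "y \<in> verts G" "y \<notin> V"
      using Suc.prems by blast
    \<comment> \<open>A walk from a vertex of \<open>V\<close> to one outside must use an edge that
      leaves \<open>V\<close>.\<close>
    have "(x, y) \<in> {(x, y). {x, y} \<in> edges G}\<^sup>*"
      using x y Suc.prems by (auto simp: connected_graph_def)
    then have "\<exists>u w. u \<in> V \<and> w \<notin> V \<and> {u, w} \<in> edges G"
      using y(2) by (induction rule: rtrancl_induct) (use x in blast)+
    then obtain u w where uw: "u \<in> V" "w \<notin> V" "{u, w} \<in> edges G"
      by blast
    have w: "w \<in> verts G"
      using uw(3) Suc.prems(1) by (auto simp: simple_graph_def doubleton_eq_iff)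
    have finV: "finite V"
      using Suc.prems fin by (auto intro: finite_subset)
    \<comment> \<open>One new edge and one new vertex preserve the hypothesis that compares the
      cardinalities.\<close>
    have "finite E"
      using Suc.prems finE by (auto intro: finite_subset)
    moreover have "{u, w} \<notin> E"
      using uw Suc.prems by auto
    ultimately have cardE: "card (insert {u, w} E) = Suc (card E)"
      by simp
    have cardV: "card (insert w V) = Suc (card V)"
      using uw finV by simp
    have "int (card (colorings q (verts G) (edges G))) =
      (int q - 1) ^ (card (verts G) - card (insert w V)) *
        int (card (colorings q (insert w V) (insert {u, w} E)))"
      using Suc.prems Suc.hyps(2) uw w cardE cardV by (intro Suc.hyps(1)) auto
    also have "\<dots> = (int q - 1) ^ Suc (card (verts G) - card (insert w V)) * int (card (colorings q V E))"
      using uw Suc.prems finV by (subst card_colorings_insert_pendant) auto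
    also have "Suc (card (verts G) - card (insert w V)) = card (verts G) - card V"
      using Suc.hyps(2) cardV by simp
    finally show ?case .
  }
qed


section \<open>Colorings of bicyclic graphs\<close>

lemma card_colorings_singleton: "card (colorings q {a} {}) = q"
proof -
  have "colorings q {a} {} = {a} \<rightarrow>\<^sub>E {..<q}"
    by (auto simp: colorings_def)
  then show ?thesis
    by (simp add: card_PiE)
qed

lemma sum_colorings_pair:
  fixes g :: "bool \<Rightarrow> int"
  assumes "u \<noteq> v"
  shows "(\<Sum>\<kappa>\<in>colorings q {u, v} {}. g (\<kappa> u = \<kappa> v)) =
         int q * g True + int q * (int q - 1) * g False"
proof -
  let ?C = "colorings q {u, v} {}"
  have all: "int (card ?C) = int q * int q"
  proof -
    have "?C = {u, v} \<rightarrow>\<^sub>E {..<q}"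
      by (auto simp: colorings_def)
    then show ?thesis
      using assms by (simp add: card_PiE)
  qed
  have "int (card (colorings q (insert v {u}) (insert {u, v} {}))) = (int q - 1) * int q"
    using assms by (subst card_colorings_insert_pendant) (auto simp: card_colorings_singleton)
  then have proper: "(\<Sum>\<kappa>\<in>?C. of_bool (\<kappa> u \<noteq> \<kappa> v)) = (int q - 1) * int q"
    using sum_colorings_insert_edge[of "{u, v}" "\<lambda>_. 1" q u v "{}"]
    by (simp add: insert_commute)
  \<comment> \<open>Any function of a truth value is affine in its indicator, so counting the pairs
    of distinct colors suffices.\<close>
  have "(\<Sum>\<kappa>\<in>?C. g (\<kappa> u = \<kappa> v)) =
        (\<Sum>\<kappa>\<in>?C. g True + (g False - g True) * of_bool (\<kappa> u \<noteq> \<kappa> v))"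
    by (intro sum.cong) auto
  also have "\<dots> = int (card ?C) * g True + (g False - g True) * ((int q - 1) * int q)"
    by (simp only: sum.distrib sum_constant of_nat_id flip: sum_distrib_left proper)
  finally show ?thesis
    by (simp add: all algebra_simps)
qed

lemma path_endsE:
  assumes "is_path p" "length p = k + 1" "k \<ge> 1"
  obtains ws where "p = hd p # ws @ [last p]" "length ws = k - 1"
    "distinct ws" "hd p \<notin> set ws" "last p \<notin> set ws" "hd p \<noteq> last p"
proof -
  obtain x xs where p: "p = x # xs"
    using assms by (cases p) auto
  moreover obtain ws y where "xs = ws @ [y]"
    using assms p by (cases xs rule: rev_cases) auto
  ultimately show ?thesis
    using assms that[of ws] by (auto simp: is_path_def)
qed

text \<open>The three paths are ears added in turn to the two isolated vertices \<open>u\<close> and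
  \<open>v\<close>; a path with \<open>n\<close> edges has \<open>n - 1\<close> inner
  vertices.\<close>

lemma type_II_core_colorings:
  assumes "type_II_core H k l m" "q \<ge> 1"
  defines "y \<equiv> int q - 1"
  shows "int q * int (card (colorings q (verts H) (edges H))) =
         y ^ (k + l + m) + (- 1) ^ (k + l) * y ^ (m + 1) + (- 1) ^ (k + m) * y ^ (l + 1) +
         (- 1) ^ (l + m) * y ^ (k + 1) + (- 1) ^ (k + l + m) * (y\<^sup>2 - y)"
    and "card (verts H) + 1 = k + l + m"
proof -
  obtain u v p1 p2 p3 where
    lens: "k \<ge> 1" "l \<ge> 1" "m \<ge> 1" and
    p: "is_path p1" "length p1 = k + 1" "hd p1 = u" "last p1 = v"
       "is_path p2" "length p2 = l + 1" "hd p2 = u" "last p2 = v"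
       "is_path p3" "length p3 = m + 1" "hd p3 = u" "last p3 = v" and
    disj: "set p1 \<inter> set p2 = {u, v}" "set p1 \<inter> set p3 = {u, v}" "set p2 \<inter> set p3 = {u, v}" and
    H: "verts H = set p1 \<union> set p2 \<union> set p3"
       "edges H = path_edges p1 \<union> path_edges p2 \<union> path_edges p3"
    using assms(1) unfolding type_II_core_def by blast
  obtain w1 where w1: "p1 = u # w1 @ [v]" "length w1 = k - 1"
    "distinct w1" "u \<notin> set w1" "v \<notin> set w1" "u \<noteq> v"
    using path_endsE[OF p(1,2) lens(1)] p(3,4) by metis
  obtain w2 where w2: "p2 = u # w2 @ [v]" "length w2 = l - 1"
    "distinct w2" "u \<notin> set w2" "v \<notin> set w2"
    using path_endsE[OF p(5,6) lens(2)] p(7,8) by metis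
  obtain w3 where w3: "p3 = u # w3 @ [v]" "length w3 = m - 1"
    "distinct w3" "u \<notin> set w3" "v \<notin> set w3"
    using path_endsE[OF p(9,10) lens(3)] p(11,12) by metis
  have dw: "set w1 \<inter> set w2 = {}" "set w1 \<inter> set w3 = {}" "set w2 \<inter> set w3 = {}"
    using disj w1 w2 w3 by auto
  let ?V1 = "{u, v} \<union> set w1" and ?E1 = "{} \<union> path_edges (u # w1 @ [v])"
  let ?V2 = "?V1 \<union> set w2" and ?E2 = "?E1 \<union> path_edges (u # w2 @ [v])"
  let ?V3 = "?V2 \<union> set w3" and ?E3 = "?E2 \<union> path_edges (u # w3 @ [v])"
  have V: "verts H = ?V3" and E: "edges H = ?E3"
    using H w1(1) w2(1) w3(1) by auto
  have E1: "?E1 \<subseteq> Pow ?V1"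
    using path_edges_subset[of "u # w1 @ [v]"] by auto
  have E2: "?E2 \<subseteq> Pow ?V2"
    using E1 path_edges_subset[of "u # w2 @ [v]"] by auto
  define e where "e n same = ear_count q (n - 1) same" for n same
  \<comment> \<open>Ears are removed from last to first. Since all have the ends \<open>u\<close>
    and \<open>v\<close>, the factors already obtained become the weight in the next
    application.\<close>
  have "int (card (colorings q ?V3 ?E3)) = (\<Sum>\<kappa>\<in>colorings q ?V2 ?E2. e m (\<kappa> u = \<kappa> v))"
    using sum_colorings_ear[of ?V2 u v u v w3 ?E2 "\<lambda>_ _. 1" q] E2 w3 dw w1(6)
    by (simp add: e_def Int_Un_distrib Int_commute)
  also have "\<dots> = (\<Sum>\<kappa>\<in>colorings q ?V1 ?E1. e l (\<kappa> u = \<kappa> v) * e m (\<kappa> u = \<kappa> v))"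
    using sum_colorings_ear[of ?V1 u v u v w2 ?E1 "\<lambda>a b. e m (a = b)" q] E1 w2 dw w1(6)
    by (simp add: e_def Int_Un_distrib Int_commute)
  also have "\<dots> = (\<Sum>\<kappa>\<in>colorings q {u, v} {}.
      e k (\<kappa> u = \<kappa> v) * (e l (\<kappa> u = \<kappa> v) * e m (\<kappa> u = \<kappa> v)))"
    using sum_colorings_ear[of "{u, v}" u v u v w1 "{}" "\<lambda>a b. e l (a = b) * e m (a = b)" q] w1
    by (simp add: e_def)
  also have "\<dots> = int q * (e k True * (e l True * e m True)) +
      int q * (int q - 1) * (e k False * (e l False * e m False))"
    using sum_colorings_pair[OF w1(6), of "\<lambda>b. e k b * (e l b * e m b)" q] by simp
  finally have count: "int (card (colorings q (verts H) (edges H))) =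
      int q * (e k True * (e l True * e m True)) + int q * y * (e k False * (e l False * e m False))"
    unfolding V E y_def .
  have closed: "int q * e n True = y ^ n + (- 1) ^ n * y" "int q * e n False = y ^ n - (- 1) ^ n"
    if "n \<ge> 1" for n
    using ear_count_closed[of q "n - 1"] that by (simp_all add: e_def y_def)
  let ?P = "y ^ (k + l + m) + (- 1) ^ (k + l) * y ^ (m + 1) + (- 1) ^ (k + m) * y ^ (l + 1) +
         (- 1) ^ (l + m) * y ^ (k + 1) + (- 1) ^ (k + l + m) * (y\<^sup>2 - y)"
  \<comment> \<open>The two extra factors \<open>q\<close>, with the one already in the count,
    supply one factor for each closed ear count.\<close>
  have "int q * (int q * int (card (colorings q (verts H) (edges H)))) =
      (int q * e k True) * (int q * e l True) * (int q * e m True) +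
      y * ((int q * e k False) * (int q * e l False) * (int q * e m False))"
    unfolding count by (simp add: algebra_simps)
  \<comment> \<open>In the expansion the terms with exactly two of the powers \<open>y ^ k\<close>,
    \<open>y ^ l\<close>, \<open>y ^ m\<close> cancel, and the rest is divisible by
    \<open>y + 1 = q\<close>.\<close>
  also have "\<dots> = (y + 1) * ?P"
    unfolding closed[OF lens(1)] closed[OF lens(2)] closed[OF lens(3)]
    by (simp add: algebra_simps power_add power2_eq_square)
  also have "y + 1 = int q"
    by (simp add: y_def)
  finally show "int q * int (card (colorings q (verts H) (edges H))) = ?P"
    using assms(2) by simp
  have "card (verts H) = card (set (u # v # w1 @ w2 @ w3))"
    unfolding V by (rule arg_cong[of _ _ card]) auto
  also have "\<dots> = length (u # v # w1 @ w2 @ w3)"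
    using w1 w2 w3 dw by (intro distinct_card) auto
  finally show "card (verts H) + 1 = k + l + m"
    using w1(2) w2(2) w3(2) lens by simp
qed

text \<open>Starting from one vertex, the first cycle, the connecting path and the second cycle are
  attached at single vertices, so their factors multiply. Here \<open>h\<close> is the number of
  edges of the connecting path.\<close>

lemma type_I_core_colorings:
  assumes "type_I_core H s t" "q \<ge> 1"
  defines "y \<equiv> int q - 1"
  obtains h where
    "int q * int (card (colorings q (verts H) (edges H))) =
       y ^ h * ((y ^ s + (- 1) ^ s * y) * (y ^ t + (- 1) ^ t * y))"
    "card (verts H) + 1 = s + t + h" "s \<ge> 3" "t \<ge> 3"
proof -
  obtain c d p where
    c: "is_cycle c" "length c = s" and d: "is_cycle d" "length d = t" and p: "is_path p" and
    disj: "set c \<inter> set p = {hd p}" "set d \<inter> set p = {last p}"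
      "set c \<inter> set d = (if length p = 1 then {hd p} else {})" and
    H: "verts H = set c \<union> set d \<union> set p"
       "edges H = cycle_edges c \<union> cycle_edges d \<union> path_edges p"
    using assms(1) unfolding type_I_core_def by blast
  obtain a ws where pa: "p = a # ws" "distinct ws" "a \<notin> set ws"
    using p by (cases p) (auto simp: is_path_def)
  have set_p: "set p = insert a (set ws)" "hd p = a"
    using pa by simp_all
  have cp: "set c \<inter> insert a (set ws) = {a}"
    using disj(1) set_p by simp
  then have a: "a \<in> set c"
    by (metis Int_iff singletonI)
  have "x \<notin> set c" if "x \<in> set ws" for x
    using cp that pa(3) by (metis Int_iff insert_iff singletonD)
  then have disj_c: "set c \<inter> {a} = {a}" "set ws \<inter> set c = {}" "a \<in> set c"
    using a by auto
  \<comment> \<open>Whether the cycles share a vertex or not, the second one meets what is already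
    built in \<open>last p\<close> alone.\<close>
  have disj_d: "set d \<inter> (set c \<union> set ws) = {last p}"
  proof (cases "ws = []")
    case True
    then show ?thesis
      using disj(3) pa(1) by (simp add: Int_commute)
  next
    case False
    then have "set c \<inter> set d = {}"
      using disj(3) pa(1) by simp
    then have "set d \<inter> (set c \<union> set ws) = set d \<inter> insert a (set ws)"
      using a by blast
    then show ?thesis
      using disj(2) by (simp only: set_p(1))
  qed
  have edges_c: "cycle_edges c \<subseteq> Pow (set c)"
  proof -
    have "{last c, hd c} \<subseteq> set c"
      using c by (cases c) (auto simp: is_cycle_def)
    then show ?thesis
      using path_edges_subset[of c] by (auto simp: cycle_edges_def)
  qed
  let ?V = "set c \<union> set ws" and ?E = "cycle_edges c \<union> path_edges (a # ws)"
  have edges_p: "?E \<subseteq> Pow ?V"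
    using edges_c path_edges_subset[of "a # ws"] disj_c(3) by auto
  have "int (card (colorings q (set c) (cycle_edges c))) = ear_count q (s - 1) True * int q"
    using card_colorings_cycle[of "{a}" c a "{}" q] c disj_c
    by (simp add: is_cycle_def card_colorings_singleton insert_absorb)
  moreover have "int (card (colorings q ?V ?E)) =
      y ^ length ws * int (card (colorings q (set c) (cycle_edges c)))"
    unfolding y_def by (rule card_colorings_path[OF _ disj_c(3) pa(2) disj_c(2) edges_c]) simp
  moreover have "int (card (colorings q (?V \<union> set d) (?E \<union> cycle_edges d))) =
      ear_count q (t - 1) True * int (card (colorings q ?V ?E))"
    using card_colorings_cycle[of ?V d "last p" ?E q] d disj_d edges_p by (simp add: is_cycle_def)
  moreover have "verts H = ?V \<union> set d" "edges H = ?E \<union> cycle_edges d"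
    unfolding H pa(1) using disj_c(3) by auto
  ultimately have count: "int (card (colorings q (verts H) (edges H))) =
      ear_count q (t - 1) True * (y ^ length ws * (ear_count q (s - 1) True * int q))"
    by simp
  have closed: "int q * ear_count q (n - 1) True = y ^ n + (- 1) ^ n * y" if "n \<ge> 3" for n
    using ear_count_closed[of q "n - 1"] that by (simp add: y_def)
  have st: "s \<ge> 3" "t \<ge> 3"
    using c d by (auto simp: is_cycle_def)
  show ?thesis
  proof (rule that[OF _ _ st])
    have "int q * int (card (colorings q (verts H) (edges H))) =
        y ^ length ws * ((int q * ear_count q (s - 1) True) * (int q * ear_count q (t - 1) True))"
      unfolding count by (simp add: algebra_simps)
    then show "int q * int (card (colorings q (verts H) (edges H))) =
       y ^ length ws * ((y ^ s + (- 1) ^ s * y) * (y ^ t + (- 1) ^ t * y))"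
      unfolding closed[OF st(1)] closed[OF st(2)] .
    have "verts H = ?V \<union> set d"
      unfolding H pa(1) using disj_c(3) by auto
    then have "card (verts H) + card (?V \<inter> set d) = card ?V + card (set d)"
      using card_Un_Int[of ?V "set d"] by simp
    moreover have "card (?V \<inter> set d) = 1"
      unfolding Int_commute[of _ "set d"] disj_d by simp
    moreover have "card ?V = s + length ws"
    proof -
      have "set c \<inter> set ws = {}"
        using disj_c(2) by blast
      then show ?thesis
        using c pa(2) by (simp add: card_Un_disjoint is_cycle_def distinct_card)
    qed
    moreover have "card (set d) = t"
      using d by (simp add: is_cycle_def distinct_card)
    ultimately show "card (verts H) + 1 = s + t + length ws"
      by simp
  qed
qed

text \<open>Under the bounds \<open>2 * l \<le> s \<le> t\<close> and
  \<open>s + t \<le> n + 1 + l\<close>, with \<open>3 \<le> s\<close>, none of the natural number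
  subtractions truncates.\<close>

definition bicyclic_poly :: "nat \<Rightarrow> nat \<Rightarrow> nat \<Rightarrow> nat \<Rightarrow> int poly" where
  "bicyclic_poly n s t l =
     monom 1 (n + 1) + monom 1 (n + 3 + l - s - t) + monom 1 (n + 2 + l - s - t)
     - monom 1 (n + 2 - s) - monom 1 (n + 2 - t) - monom 1 (n + 2 + 2 * l - s - t)"

text \<open>Both the core \<open>H\<close> and \<open>G\<close> have one edge more than vertices, so
  each of the \<open>r\<close> vertices outside \<open>H\<close> contributes a factor
  \<open>q - 1\<close>. The last bound expresses that \<open>H\<close> has at least
  \<open>s + t - l - 1\<close> vertices.\<close>

lemma colorings_has_parameters:
  assumes "bicyclic G" "has_parameters G s t l" "q \<ge> 1"
  defines "n \<equiv> card (verts G)"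
  shows "int q * int (card (colorings q (verts G) (edges G))) =
           (- 1) ^ (n + 1) * poly (bicyclic_poly n s t l) (1 - int q)"
    and "3 \<le> s" "s \<le> t" "2 * l \<le> s" "s + t \<le> n + 1 + l"
proof -
  obtain H where H: "minimal_bicyclic_subgraph H G" and
    core: "type_I_core H s t \<and> s \<le> t \<and> l = 0 \<or>
         (\<exists>k m. type_II_core H k l m \<and> l \<le> k \<and> k \<le> m \<and> s = l + k \<and> t = l + m)"
    using assms(2) by (auto simp: has_parameters_def)
  have sub: "subgraph H G" and bH: "bicyclic H"
    using H by (auto simp: minimal_bicyclic_subgraph_def)
  define r where "r = n - card (verts H)"
  define z where "z = 1 - int q"
  have y: "int q - 1 = - z"
    by (simp add: z_def)
  have "card (verts H) \<le> n"
    using sub assms(1) unfolding n_def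
    by (intro card_mono) (auto simp: subgraph_def bicyclic_def simple_graph_def)
  then have n: "n = r + card (verts H)"
    by (simp add: r_def)
  have "edges H \<subseteq> Pow (verts H)"
    using bH by (force simp: bicyclic_def simple_graph_def)
  then have "int (card (colorings q (verts G) (edges G))) =
      (int q - 1) ^ r * int (card (colorings q (verts H) (edges H)))"
    unfolding r_def n_def using assms(1) sub bH
    by (intro card_colorings_connected_supergraph)
      (auto simp: bicyclic_def subgraph_def connected_graph_def)
  then have grow: "int q * int (card (colorings q (verts G) (edges G))) =
      (- z) ^ r * (int q * int (card (colorings q (verts H) (edges H))))"
    by (simp add: y)
  have sign: "(- z) ^ i = (- 1) ^ i * z ^ i" for i
    by (rule power_minus)
  have "int q * int (card (colorings q (verts G) (edges G))) =
           (- 1) ^ (n + 1) * poly (bicyclic_poly n s t l) z \<and>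
        3 \<le> s \<and> s \<le> t \<and> 2 * l \<le> s \<and> s + t \<le> n + 1 + l"
    using core
  proof (elim disjE exE conjE)
    assume I: "type_I_core H s t" "s \<le> t" "l = 0"
    obtain h where count: "int q * int (card (colorings q (verts H) (edges H))) =
       (- z) ^ h * (((- z) ^ s + (- 1) ^ s * - z) * ((- z) ^ t + (- 1) ^ t * - z))"
      and h: "card (verts H) + 1 = s + t + h" "s \<ge> 3" "t \<ge> 3"
      using type_I_core_colorings[OF I(1) assms(3)] unfolding y by metis
    \<comment> \<open>As \<open>l = 0\<close>, one positive and one negative monomial have the same
      exponent and cancel.\<close>
    have exps: "n + 1 = r + h + s + t" "n + 3 + l - s - t = r + h + 2"
      "n + 2 + 2 * l - s - t = n + 2 + l - s - t"
      "n + 2 - s = r + h + t + 1" "n + 2 - t = r + h + s + 1"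
      using n h I by auto
    have poly: "poly (bicyclic_poly n s t l) z =
        z ^ (r + h + s + t) + z ^ (r + h + 2) - z ^ (r + h + t + 1) - z ^ (r + h + s + 1)"
      unfolding bicyclic_poly_def exps by (simp add: poly_monom)
    have "int q * int (card (colorings q (verts G) (edges G))) =
           (- 1) ^ (n + 1) * poly (bicyclic_poly n s t l) z"
      unfolding grow count sign poly exps(1)
      by (simp add: algebra_simps power_add power2_eq_square)
    then show ?thesis
      using I h n by auto
  next
    fix k m
    assume II: "type_II_core H k l m" "l \<le> k" "k \<le> m" "s = l + k" "t = l + m"
    note count = type_II_core_colorings(1)[OF II(1) assms(3), unfolded y]
    note v = type_II_core_colorings(2)[OF II(1) assms(3)]
    \<comment> \<open>As \<open>l \<le> k\<close> and at most one path is a single edge,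
      \<open>k\<close> is at least 2.\<close>
    have st: "3 \<le> s" "1 \<le> l"
      using II by (auto simp: type_II_core_def)
    have exps: "n + 1 = r + k + l + m" "n + 3 + l - s - t = r + 2" "n + 2 + l - s - t = r + 1"
      "n + 2 - s = r + m + 1" "n + 2 - t = r + k + 1" "n + 2 + 2 * l - s - t = r + l + 1"
      using n v II by auto
    have "int q * int (card (colorings q (verts G) (edges G))) =
           (- 1) ^ (n + 1) * poly (bicyclic_poly n s t l) z"
      unfolding grow count sign bicyclic_poly_def exps
      by (simp add: poly_monom algebra_simps power_add power2_eq_square)
    then show ?thesis
      using II st n v by auto
  qed
  then show "int q * int (card (colorings q (verts G) (edges G))) =
           (- 1) ^ (n + 1) * poly (bicyclic_poly n s t l) (1 - int q)"
    and "3 \<le> s" "s \<le> t" "2 * l \<le> s" "s + t \<le> n + 1 + l"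
    by (auto simp: z_def)
qed


section \<open>Reading off the parameters\<close>

lemma coeff_bicyclic_poly:
  "coeff (bicyclic_poly n s t l) e =
     of_bool (e = n + 1) + of_bool (e = n + 3 + l - s - t) + of_bool (e = n + 2 + l - s - t)
     - of_bool (e = n + 2 - s) - of_bool (e = n + 2 - t) - of_bool (e = n + 2 + 2 * l - s - t)"
  by (simp add: bicyclic_poly_def eq_commute[of e])

text \<open>The exponents \<open>n + 2 - s \<ge> n + 2 - t \<ge> n + 2 + 2 * l - s - t\<close> of the negative terms are read off
  in this order; positive terms cannot cancel the first two, nor the third one if \<open>l \<ge> 2\<close>.\<close>

lemma bicyclic_poly_inject:
  assumes "3 \<le> s" "s \<le> t" "2 * l \<le> s" "s + t \<le> n + 1 + l"
    and "3 \<le> s'" "s' \<le> t'" "2 * l' \<le> s'" "s' + t' \<le> n + 1 + l'"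
    and eq: "bicyclic_poly n s t l = bicyclic_poly n s' t' l'"
  shows "s = s'" "t = t'" "l \<ge> 2 \<Longrightarrow> l = l'"
proof -
  \<comment> \<open>The inequality is proved for arbitrary parameters, so that exchanging the two
    graphs gives equality.\<close>
  have s_le: "s' \<le> s"
    if "3 \<le> s" "s \<le> t" "2 * l \<le> s" "s + t \<le> n + 1 + l"
      and "3 \<le> s'" "s' \<le> t'" "2 * l' \<le> s'" "s' + t' \<le> n + 1 + l'"
      and eq: "bicyclic_poly n s t l = bicyclic_poly n s' t' l'"
    for s t l s' t' l'
  proof (rule ccontr)
    \<comment> \<open>If \<open>s < s'\<close>, all negative terms on the right have exponents below
      \<open>?e\<close>. On the left no positive term has exponent \<open>?e\<close>, so the
      coefficient there is negative.\<close>
    let ?e = "n + 2 - s"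
    assume "\<not> s' \<le> s"
    then have "?e \<noteq> n + 1" "?e \<noteq> n + 3 + l - s - t" "?e \<noteq> n + 2 + l - s - t"
      "?e \<noteq> n + 2 - s'" "?e \<noteq> n + 2 - t'" "?e \<noteq> n + 2 + 2 * l' - s' - t'"
      using that by linarith+
    then show False
      using arg_cong[OF eq, of "\<lambda>p. coeff p ?e"] unfolding coeff_bicyclic_poly
      by (simp add: of_bool_def split: if_splits)
  qed
  show s: "s = s'"
    using s_le[OF assms] s_le[OF assms(5-8) assms(1-4) eq[symmetric]] by simp
  have t_le: "t' \<le> t"
    if "3 \<le> s" "s \<le> t" "2 * l \<le> s" "s + t \<le> n + 1 + l"
      and "s \<le> t'" "2 * l' \<le> s" "s + t' \<le> n + 1 + l'"
      and eq: "bicyclic_poly n s t l = bicyclic_poly n s t' l'"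
    for t l t' l'
  proof (rule ccontr)
    \<comment> \<open>The term of exponent \<open>n + 2 - s\<close> is common to both sides. Apart
      from it, the coefficient at \<open>?e\<close> is negative on the left and zero on the
      right.\<close>
    let ?e = "n + 2 - t"
    assume "\<not> t' \<le> t"
    then have "?e \<noteq> n + 1" "?e \<noteq> n + 3 + l - s - t" "?e \<noteq> n + 2 + l - s - t"
      "?e \<noteq> n + 3 + l' - s - t'" "?e \<noteq> n + 2 + l' - s - t'"
      "?e \<noteq> n + 2 - t'" "?e \<noteq> n + 2 + 2 * l' - s - t'"
      using that by linarith+
    then show False
      using arg_cong[OF eq, of "\<lambda>p. coeff p ?e"] unfolding coeff_bicyclic_poly
      by (simp add: of_bool_def split: if_splits)
  qed
  show t: "t = t'"
    using t_le[of t l t' l'] t_le[of t' l' t l] assms s by simp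
  show "l = l'" if "l \<ge> 2"
  proof (rule ccontr)
    \<comment> \<open>The first two negative terms now agree on both sides. For
      \<open>l \<ge> 2\<close> no positive term on the left has exponent \<open>?e\<close>, while on
      the right only positive terms can remain there.\<close>
    let ?e = "n + 2 + 2 * l - s - t"
    assume "l \<noteq> l'"
    then have "?e \<noteq> n + 1" "?e \<noteq> n + 3 + l - s - t" "?e \<noteq> n + 2 + l - s - t"
      "?e \<noteq> n + 2 + 2 * l' - s - t"
      using that assms s t by linarith+
    then show False
      using arg_cong[OF eq, of "\<lambda>p. coeff p ?e"] unfolding coeff_bicyclic_poly
      by (simp add: of_bool_def s t split: if_splits)
  qed
qed

section \<open>From the chromatic symmetric function to numbers of colorings\<close>

text \<open>This is the specialization of the first \<open>q\<close> variables to 1 and of the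
  others to 0. The index set is expressed through the coefficients alone, so the sum depends only on
  the function.\<close>

lemma card_colorings_eq_sum_coefficients:
  assumes "finite (verts G)"
  shows "int (card (colorings q (verts G) (edges G))) =
         (\<Sum>M | chromatic_symmetric_function G M \<noteq> 0 \<and> set_mset M \<subseteq> {..<q}.
            chromatic_symmetric_function G M)"
proof -
  let ?C = "colorings q (verts G) (edges G)"
  have C: "?C = {\<kappa> \<in> proper_colorings G. set_mset (color_monomial G \<kappa>) \<subseteq> {..<q}}"
    using assms by (auto simp: colorings_def proper_colorings_def color_monomial_def PiE_iff)
  have "int (card ?C) = (\<Sum>M\<in>color_monomial G ` ?C. \<Sum>\<kappa> | \<kappa> \<in> ?C \<and> color_monomial G \<kappa> = M. 1)"
    using sum.image_gen[OF finite_colorings[OF assms], of "\<lambda>_. 1 :: int" q "edges G" "color_monomial G"]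
    by simp
  also have "\<dots> = (\<Sum>M\<in>color_monomial G ` ?C. chromatic_symmetric_function G M)"
  proof (rule sum.cong[OF refl])
    fix M assume "M \<in> color_monomial G ` ?C"
    then have "{\<kappa> \<in> ?C. color_monomial G \<kappa> = M} = {\<kappa> \<in> proper_colorings G. color_monomial G \<kappa> = M}"
      unfolding C by auto
    then show "(\<Sum>\<kappa> | \<kappa> \<in> ?C \<and> color_monomial G \<kappa> = M. 1) = chromatic_symmetric_function G M"
      by (simp add: chromatic_symmetric_function_def)
  qed
  \<comment> \<open>A coefficient is the cardinality of a finite set, so it is nonzero exactly if
    some coloring has this monomial.\<close>
  also have "color_monomial G ` ?C =
      {M. chromatic_symmetric_function G M \<noteq> 0 \<and> set_mset M \<subseteq> {..<q}}"
    unfolding C chromatic_symmetric_function_def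
    using finite_colorings_of_monomial[OF assms] by auto
  finally show ?thesis .
qed

text \<open>Distinct colors for all vertices give a proper coloring. The degree of any monomial that
  occurs then reveals the number of vertices.\<close>

lemma chromatic_symmetric_function_nonzeroE:
  assumes "simple_graph G"
  obtains M where "chromatic_symmetric_function G M \<noteq> 0"
proof -
  have fin: "finite (verts G)"
    using assms by (simp add: simple_graph_def)
  then obtain f :: "'a \<Rightarrow> nat" where f: "inj_on f (verts G)"
    using finite_imp_inj_to_nat_seg by blast
  have "u \<in> verts G \<and> v \<in> verts G \<and> u \<noteq> v" if "{u, v} \<in> edges G" for u v
    using that assms by (fastforce simp: simple_graph_def doubleton_eq_iff)
  then have "restrict f (verts G) \<in> proper_colorings G"
    using f by (auto simp: proper_colorings_def dest: inj_onD)
  then show ?thesis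
    using that[of "color_monomial G (restrict f (verts G))"] finite_colorings_of_monomial[OF fin]
    by (auto simp: chromatic_symmetric_function_def)
qed

lemma size_monomial:
  assumes "chromatic_symmetric_function G M \<noteq> 0"
  shows "size M = card (verts G)"
proof -
  have "{\<kappa> \<in> proper_colorings G. color_monomial G \<kappa> = M} \<noteq> {}"
    using assms by (intro notI) (simp add: chromatic_symmetric_function_def)
  then show ?thesis
    by (auto simp: color_monomial_def)
qed

theorem theorem7p7:
  fixes G :: "'a graph" and G' :: "'b graph"
    and s t l s' t' l' :: nat
  assumes "bicyclic G" and "bicyclic G'"
    and "has_parameters G s t l" and "has_parameters G' s' t' l'"
    and "chromatic_symmetric_function G = chromatic_symmetric_function G'"
  shows "s = s' \<and> t = t' \<and> (l \<ge> 2 \<longrightarrow> type_II G' \<and> l' = l)"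
proof -
  define n where "n = card (verts G)"
  have simple: "simple_graph G" "simple_graph G'"
    using assms(1,2) by (simp_all add: bicyclic_def)
  then have fin: "finite (verts G)" "finite (verts G')"
    by (simp_all add: simple_graph_def)
  obtain M where "chromatic_symmetric_function G M \<noteq> 0"
    using simple(1) by (rule chromatic_symmetric_function_nonzeroE)
  then have n': "card (verts G') = n"
    using size_monomial[of G M] size_monomial[of G' M] assms(5) by (simp add: n_def)
  \<comment> \<open>Nonpositive integers \<open>z\<close> correspond to numbers of colors
    \<open>q = 1 - z \<ge> 1\<close>; equality at infinitely many points identifies the
    polynomials.\<close>
  have "poly (bicyclic_poly n s t l) z = poly (bicyclic_poly n s' t' l') z" if "z \<le> 0" for z
  proof -
    define q where "q = nat (1 - z)"
    have q: "q \<ge> 1" "1 - int q = z"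
      using that by (auto simp: q_def)
    have "card (colorings q (verts G) (edges G)) = card (colorings q (verts G') (edges G'))"
      using card_colorings_eq_sum_coefficients[OF fin(1), of q]
        card_colorings_eq_sum_coefficients[OF fin(2), of q] assms(5) by simp
    then show ?thesis
      using colorings_has_parameters(1)[OF assms(1,3) q(1)]
        colorings_has_parameters(1)[OF assms(2,4) q(1)]
      by (simp add: q(2) n' flip: n_def)
  qed
  then have "{..0} \<subseteq> {z. poly (bicyclic_poly n s t l - bicyclic_poly n s' t' l') z = 0}"
    by auto
  then have "infinite {z. poly (bicyclic_poly n s t l - bicyclic_poly n s' t' l') z = 0}"
    by (rule infinite_super) (rule infinite_Iic)
  then have eq: "bicyclic_poly n s t l = bicyclic_poly n s' t' l'"
    using poly_roots_finite[of "bicyclic_poly n s t l - bicyclic_poly n s' t' l'"] by auto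
  have "s = s'" "t = t'" "l \<ge> 2 \<Longrightarrow> l = l'"
    by (rule bicyclic_poly_inject[OF
        colorings_has_parameters(2-5)[OF assms(1,3) order_refl, folded n_def]
        colorings_has_parameters(2-5)[OF assms(2,4) order_refl, unfolded n'] eq])+
  \<comment> \<open>Type-I parameters have last entry 0, which \<open>l' \<ge> 2\<close>
    excludes.\<close>
  moreover have "type_II G'" if "l' \<ge> 2"
  proof -
    obtain H k m where "minimal_bicyclic_subgraph H G'" "type_II_core H k l' m"
      using assms(4) \<open>l' \<ge> 2\<close> unfolding has_parameters_def by auto
    then show ?thesis
      unfolding type_II_def by blast
  qed
  ultimately show ?thesis
    by auto
qed

end
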